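(* Let $D$ be a digraph on $n$ vertices and let $k\ge 2\delta^*_{\min}(D)+2$ be an integer. Then the diameter of ${\cal D}_k(D)$ is at most $(\delta^*_{\min}(D)+1)n$.
   Context: A $k$-dicolouring of a digraph $D$ is a map $V(D)\to\{1,\dots,k\}$ with no monochromatic directed cycle. ${\cal D}_k(D)$ is the graph whose vertices are the $k$-dicolourings of $D$, two adjacent if they differ on exactly one vertex. The min-degeneracy is $\delta^*_{\min}(D)=\max\{\min\{\delta^+(H),\delta^-(H)\} : H \text{ subdigraph of } D\}$. *)

theory Defs
  imports
    "Graph_Theory.Digraph_Component"
    "Graph_Theory.Shortest_Path"
    "HOL-Library.FuncSet"
begin

definition min_out_degree :: "('a, 'b) pre_digraph \<Rightarrow> nat" where
  "min_out_degree H = Min (out_degree H ` verts H)"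

definition min_in_degree :: "('a, 'b) pre_digraph \<Rightarrow> nat" where
  "min_in_degree H = Min (in_degree H ` verts H)"

text \<open>
  The library counts the null digraph as a subgraph; it has no minimum degree and is excluded
  here. So the value is unspecified for the null digraph itself.
\<close>
definition min_degeneracy :: "('a, 'b) pre_digraph \<Rightarrow> nat" where
  "min_degeneracy D =
    Max {min (min_out_degree H) (min_in_degree H) | H. subgraph H D \<and> verts H \<noteq> {}}"

text \<open>
  Library cycles are lists of arcs, and two opposite arcs form a cycle, as usual for
  digraphs; every vertex of a cycle is the tail of one of its arcs.
  Colourings are extensional, so that they are determined by their values on the vertices.
\<close>
definition dicolouring :: "('a, 'b) pre_digraph \<Rightarrow> nat \<Rightarrow> ('a \<Rightarrow> nat) \<Rightarrow> bool" where
  "dicolouring D k f \<longleftrightarrow>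
    f \<in> verts D \<rightarrow>\<^sub>E {1..k} \<and>
    \<not> (\<exists>p c. pre_digraph.cycle D p \<and> (\<forall>e \<in> set p. f (tail D e) = c))"

definition dicolouring_graph ::
    "('a, 'b) pre_digraph \<Rightarrow> nat \<Rightarrow> ('a \<Rightarrow> nat, ('a \<Rightarrow> nat) \<times> ('a \<Rightarrow> nat)) pre_digraph" where
  "dicolouring_graph D k = with_proj
    \<lparr> pverts = {f. dicolouring D k f},
      parcs = {(f, g). dicolouring D k f \<and> dicolouring D k g \<and>
                       (\<exists>!v. v \<in> verts D \<and> f v \<noteq> g v)} \<rparr>"

text \<open>
  With unit weights \<^const>\<open>wf_digraph.\<mu>\<close> is the usual distance; it is infinite
  between vertices not joined by a walk, so a finite diameter entails connectedness.
\<close>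
definition diameter :: "('a, 'b) pre_digraph \<Rightarrow> ereal" where
  "diameter G = (SUP u \<in> verts G. SUP v \<in> verts G. wf_digraph.\<mu> G (\<lambda>_. 1) u v)"

lemma graph_dicolouring_graph:
  assumes "digraph D"
  shows "graph (dicolouring_graph D k)"
proof -
  interpret D: digraph D by fact
  let ?V = "{f. dicolouring D k f}"
  have "?V \<subseteq> verts D \<rightarrow>\<^sub>E {1..k}"
    by (auto simp: dicolouring_def)
  then have fin: "finite ?V"
    by (rule finite_subset) (simp add: finite_PiE)
  have "finite (arcs (dicolouring_graph D k))"
    by (rule finite_subset[of _ "?V \<times> ?V"]) (auto simp: dicolouring_graph_def fin)
  with fin show ?thesis
  proof unfold_locales
    have "(g, f) \<in> arcs (dicolouring_graph D k)" if "(f, g) \<in> arcs (dicolouring_graph D k)" for f g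
      using that unfolding dicolouring_graph_def by (simp add: neq_commute[of "g _" "f _"])
    then show "symmetric (dicolouring_graph D k)"
      unfolding symmetric_def sym_def dicolouring_graph_def by simp
  qed (auto simp: dicolouring_graph_def arc_to_ends_def)
qed

lemma finite_subgraphs:
  assumes "fin_digraph D"
  shows "finite {H. subgraph H D}"
proof -
  interpret D: fin_digraph D by fact
  have "{H. subgraph H D} \<subseteq> (\<lambda>(V, A). \<lparr> verts = V, arcs = A, tail = tail D, head = head D \<rparr>) `
      (Pow (verts D) \<times> Pow (arcs D))"
  proof
    fix H assume "H \<in> {H. subgraph H D}"
    then have "H = (\<lambda>(V, A). \<lparr> verts = V, arcs = A, tail = tail D, head = head D \<rparr>) (verts H, arcs H)"
      and "(verts H, arcs H) \<in> Pow (verts D) \<times> Pow (arcs D)"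
      by (simp_all add: subgraph_def compatible_def)
    then show "H \<in> (\<lambda>(V, A). \<lparr> verts = V, arcs = A, tail = tail D, head = head D \<rparr>) `
      (Pow (verts D) \<times> Pow (arcs D))"
      by (rule image_eqI)
  qed
  then show ?thesis
    by (rule finite_subset) simp
qed

end

theory Submission
  imports Defs
begin

text \<open>
  Induction on the number of vertices. Let \<open>d\<close> be the min-degeneracy and let \<open>v\<close> be a vertex with
  at most \<open>d\<close> out-neighbours, or at most \<open>d\<close> in-neighbours; call this set of neighbours \<open>N\<close>. As long
  as the colour of \<open>v\<close> does not occur on \<open>N\<close>, no monochromatic directed cycle passes through \<open>v\<close>.
  Take a recolouring sequence of \<open>D - v\<close> in which every vertex is recoloured at most \<open>d + 1\<close> times,
  so that \<open>N\<close> is recoloured at most \<open>d (d + 1)\<close> times. Whenever \<open>v\<close> has to move away, one of the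
  \<open>2d + 2\<close> colours avoids both the at most \<open>d\<close> colours on \<open>N\<close> and the colours of the next \<open>d + 1\<close>
  recolourings of \<open>N\<close>. Hence \<open>v\<close> moves at most \<open>d\<close> times (including one move at the very
  beginning), and one last move gives it its final colour.
\<close>

section \<open>Acyclic colourings of a relation\<close>

text \<open>The vertex set is a parameter of its own, so that the induction can delete vertices
  while \<open>E\<close> stays fixed and colourings remain total functions.\<close>

definition mono_rel :: "('a \<times> 'a) set \<Rightarrow> 'a set \<Rightarrow> ('a \<Rightarrow> nat) \<Rightarrow> ('a \<times> 'a) set" where
  "mono_rel E V f = {(x, y) \<in> E. x \<in> V \<and> y \<in> V \<and> f x = f y}"

definition acyclic_colouring :: "('a \<times> 'a) set \<Rightarrow> nat \<Rightarrow> 'a set \<Rightarrow> ('a \<Rightarrow> nat) \<Rightarrow> bool" where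
  "acyclic_colouring E k V f \<longleftrightarrow> f ` V \<subseteq> {1..k} \<and> acyclic (mono_rel E V f)"

lemma acyclic_colouring_cong:
  assumes "\<And>x. x \<in> V \<Longrightarrow> f x = g x"
  shows "acyclic_colouring E k V f \<longleftrightarrow> acyclic_colouring E k V g"
proof -
  have "mono_rel E V f = mono_rel E V g" "f ` V = g ` V"
    using assms by (auto simp: mono_rel_def)
  then show ?thesis by (simp add: acyclic_colouring_def)
qed

lemma acyclic_colouring_subset:
  assumes "acyclic_colouring E k V f" "W \<subseteq> V"
  shows "acyclic_colouring E k W f"
proof -
  have "mono_rel E W f \<subseteq> mono_rel E V f"
    using assms(2) by (auto simp: mono_rel_def)
  with assms show ?thesis
    unfolding acyclic_colouring_def by (meson acyclic_subset image_mono subset_trans)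
qed

text \<open>A path of \<open>M\<close> cannot continue after \<open>v\<close>, so it ends in
  \<open>v\<close> or runs entirely inside \<open>A\<close>. A cycle of \<open>M\<close> avoids
  \<open>v\<close>, which has no successor, and would therefore be a cycle of
  \<open>A\<close>.\<close>

lemma acyclic_add_sink:
  assumes "acyclic A" "M \<subseteq> A \<union> UNIV \<times> {v}" "v \<notin> Domain M"
  shows "acyclic M"
proof -
  have *: "y = v \<or> (x, y) \<in> A\<^sup>+" if "(x, y) \<in> M\<^sup>+" for x y
    using that
  proof (induction rule: trancl_induct)
    case (base y)
    with assms(2) show ?case by blast
  next
    case (step y z)
    with assms(3) have "(x, y) \<in> A\<^sup>+" by blast
    with step(2) assms(2) show ?case by (blast intro: trancl_into_trancl)
  qed
  show ?thesis
  proof (rule acyclicI, intro allI notI)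
    fix x assume x: "(x, x) \<in> M\<^sup>+"
    then have "x \<in> Domain M" using trancl_domain[of M] by blast
    with *[OF x] assms(1,3) show False by (auto simp: acyclic_def)
  qed
qed

text \<open>Keeping \<open>v\<close> out of \<open>N\<close> also rules out a loop at a vertex
  \<open>v\<close> of \<open>V\<close>, which no choice of colour could make harmless.\<close>

definition in_or_out_cover :: "('a \<times> 'a) set \<Rightarrow> 'a set \<Rightarrow> 'a \<Rightarrow> 'a set \<Rightarrow> bool" where
  "in_or_out_cover E V v N \<longleftrightarrow>
    N \<subseteq> V - {v} \<and> (E `` {v} \<inter> V \<subseteq> N \<or> E\<inverse> `` {v} \<inter> V \<subseteq> N)"

text \<open>If \<open>N\<close> covers the out-neighbours, \<open>v\<close> is a sink of the
  monochromatic relation; if it covers the in-neighbours, \<open>v\<close> is a source, hence a sink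
  of the converse, and acyclicity is invariant under converse.\<close>

lemma acyclic_colouring_insert:
  assumes N: "in_or_out_cover E V v N"
    and f: "acyclic_colouring E k (V - {v}) f" "f v \<in> {1..k}" "f v \<notin> f ` N"
  shows "acyclic_colouring E k V f"
proof -
  let ?A = "mono_rel E (V - {v}) f" and ?M = "mono_rel E V f"
  have A: "acyclic ?A" using f(1) by (simp add: acyclic_colouring_def)
  have "acyclic ?M"
  proof (cases "E `` {v} \<inter> V \<subseteq> N")
    case True
    show ?thesis
    proof (rule acyclic_add_sink[OF A])
      show "v \<notin> Domain ?M" using True f(3) by (auto simp: mono_rel_def)
      then show "?M \<subseteq> ?A \<union> UNIV \<times> {v}" by (auto simp: mono_rel_def)
    qed
  next
    case False
    with N have *: "E\<inverse> `` {v} \<inter> V \<subseteq> N" by (auto simp: in_or_out_cover_def)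
    have "acyclic (?M\<inverse>)"
    proof (rule acyclic_add_sink)
      show "acyclic (?A\<inverse>)" using A by simp
      show "v \<notin> Domain (?M\<inverse>)"
      proof
        assume "v \<in> Domain (?M\<inverse>)"
        then obtain y where "(y, v) \<in> E" "y \<in> V" "f y = f v" by (auto simp: mono_rel_def)
        with * have "y \<in> N" by blast
        with f(3) \<open>f y = f v\<close> show False by (metis image_eqI)
      qed
      then show "?M\<inverse> \<subseteq> ?A\<inverse> \<union> UNIV \<times> {v}" by (auto simp: mono_rel_def)
    qed
    then show ?thesis by simp
  qed
  moreover have "f ` V \<subseteq> {1..k}"
    using f(1,2) unfolding acyclic_colouring_def by blast
  ultimately show ?thesis by (simp add: acyclic_colouring_def)
qed

section \<open>Recolouring sequences\<close>

fun recolour :: "('a \<Rightarrow> nat) \<Rightarrow> ('a \<times> nat) list \<Rightarrow> 'a \<Rightarrow> nat" where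
  "recolour f [] = f"
| "recolour f ((x, c) # xs) = recolour (f(x := c)) xs"

text \<open>A step may repeat the present colour of its vertex. Such a step still counts in
  \<open>moves\<close>, but gives no arc of the dicolouring graph.\<close>

fun recolouring :: "('a \<times> 'a) set \<Rightarrow> nat \<Rightarrow> 'a set \<Rightarrow> ('a \<Rightarrow> nat) \<Rightarrow> ('a \<times> nat) list \<Rightarrow> bool" where
  "recolouring E k V f [] \<longleftrightarrow> acyclic_colouring E k V f"
| "recolouring E k V f ((x, c) # xs) \<longleftrightarrow>
    acyclic_colouring E k V f \<and> x \<in> V \<and> recolouring E k V (f(x := c)) xs"

definition moves :: "'a \<Rightarrow> ('a \<times> nat) list \<Rightarrow> nat" where
  "moves x xs = length (filter (\<lambda>s. fst s = x) xs)"

text \<open>A list in order of time, so that \<open>take r\<close> selects the next \<open>r\<close>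
  recolourings of \<open>N\<close>.\<close>

definition colours_on :: "'a set \<Rightarrow> ('a \<times> nat) list \<Rightarrow> nat list" where
  "colours_on N xs = map snd (filter (\<lambda>s. fst s \<in> N) xs)"

lemma moves_simps [simp]:
  "moves x [] = 0"
  "moves x ((y, c) # xs) = (if y = x then Suc (moves x xs) else moves x xs)"
  "moves x (xs @ ys) = moves x xs + moves x ys"
  by (simp_all add: moves_def)

lemma colours_on_simps [simp]:
  "colours_on N [] = []"
  "colours_on N ((y, c) # xs) = (if y \<in> N then c # colours_on N xs else colours_on N xs)"
  by (simp_all add: colours_on_def)

lemma recolouring_imp_acyclic_colouring: "recolouring E k V f xs \<Longrightarrow> acyclic_colouring E k V f"
  by (cases xs) auto

lemma recolouring_steps: "recolouring E k V f xs \<Longrightarrow> fst ` set xs \<subseteq> V"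
proof (induction xs arbitrary: f)
  case (Cons s xs)
  obtain x c where s: "s = (x, c)" by force
  have "recolouring E k V (f(x := c)) xs" using Cons.prems by (simp add: s)
  then have "fst ` set xs \<subseteq> V" by (rule Cons.IH)
  with Cons.prems show ?case by (simp add: s)
qed simp

lemma recolouring_cong:
  "(\<And>x. x \<in> V \<Longrightarrow> f x = g x) \<Longrightarrow> recolouring E k V f xs \<longleftrightarrow> recolouring E k V g xs"
proof (induction xs arbitrary: f g)
  case Nil
  then have "acyclic_colouring E k V f \<longleftrightarrow> acyclic_colouring E k V g"
    by (rule acyclic_colouring_cong)
  then show ?case by simp
next
  case (Cons s xs)
  obtain x c where s: "s = (x, c)" by force
  have "recolouring E k V (f(x := c)) xs \<longleftrightarrow> recolouring E k V (g(x := c)) xs"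
    using Cons.prems by (intro Cons.IH) auto
  moreover have "acyclic_colouring E k V f \<longleftrightarrow> acyclic_colouring E k V g"
    using Cons.prems by (rule acyclic_colouring_cong)
  ultimately show ?case by (simp add: s)
qed

lemma recolour_cong: "f x = g x \<Longrightarrow> recolour f xs x = recolour g xs x"
proof (induction xs arbitrary: f g)
  case (Cons s xs)
  obtain y c where s: "s = (y, c)" by force
  have "(f(y := c)) x = (g(y := c)) x" using Cons.prems by simp
  then have "recolour (f(y := c)) xs x = recolour (g(y := c)) xs x" by (rule Cons.IH)
  then show ?case by (simp add: s)
qed simp

lemma recolour_append [simp]: "recolour f (xs @ ys) = recolour (recolour f xs) ys"
  by (induction xs arbitrary: f) auto

lemma recolouring_append:
  "recolouring E k V f (xs @ ys) \<longleftrightarrow>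
    recolouring E k V f xs \<and> recolouring E k V (recolour f xs) ys"
  by (induction xs arbitrary: f) (auto dest: recolouring_imp_acyclic_colouring)

lemma recolouring_final: "recolouring E k V f xs \<Longrightarrow> acyclic_colouring E k V (recolour f xs)"
  by (induction xs arbitrary: f) auto

lemma recolour_unmoved: "x \<notin> fst ` set xs \<Longrightarrow> recolour f xs x = f x"
  by (induction xs arbitrary: f) auto

lemma moves_filter_other: "x \<noteq> v \<Longrightarrow> moves x (filter (\<lambda>s. fst s \<noteq> v) xs) = moves x xs"
  by (induction xs) (auto simp: moves_def)

lemma recolour_filter_other:
  "x \<noteq> v \<Longrightarrow> recolour f (filter (\<lambda>s. fst s \<noteq> v) xs) x = recolour f xs x"
proof (induction xs arbitrary: f)
  case (Cons s xs)
  obtain y c where s: "s = (y, c)" by force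
  have "recolour f xs x = recolour (f(v := c)) xs x"
    using Cons.prems by (intro recolour_cong) auto
  with Cons s show ?case by auto
qed simp

lemma length_eq_sum_moves:
  "finite V \<Longrightarrow> fst ` set xs \<subseteq> V \<Longrightarrow> length xs = (\<Sum>x\<in>V. moves x xs)"
proof (induction xs)
  case (Cons s xs)
  obtain y c where s: "s = (y, c)" by force
  have "(\<Sum>x\<in>V. moves x (s # xs)) = (\<Sum>x\<in>V. (if y = x then 1 else 0) + moves x xs)"
    unfolding s by (rule sum.cong) auto
  also have "\<dots> = 1 + (\<Sum>x\<in>V. moves x xs)"
    using Cons.prems s by (simp add: sum.distrib)
  finally show ?case using Cons by simp
qed simp

lemma length_colours_on:
  assumes "finite N"
  shows "length (colours_on N xs) = (\<Sum>x\<in>N. moves x xs)"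
proof (induction xs)
  case (Cons s xs)
  obtain y c where s: "s = (y, c)" by force
  have "(\<Sum>x\<in>N. moves x (s # xs)) = (\<Sum>x\<in>N. (if y = x then 1 else 0) + moves x xs)"
    unfolding s by (rule sum.cong) auto
  also have "\<dots> = (if y \<in> N then 1 else 0) + (\<Sum>x\<in>N. moves x xs)"
    using assms by (simp add: sum.distrib)
  finally show ?case using Cons s by simp
qed simp

section \<open>Extending a recolouring sequence by one vertex\<close>

text \<open>At most \<open>d\<close> colours lie on \<open>N\<close> and at most
  \<open>d + 1\<close> in the prefix, together fewer than \<open>k\<close>. This is where the bound
  on \<open>k\<close> enters.\<close>

lemma free_colour:
  assumes "finite N" "card N \<le> d" "2 * d + 2 \<le> k"
  obtains b where "b \<in> {1..k}" "b \<notin> f ` N" "b \<notin> set (take (d + 1) cs)"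
proof -
  let ?S = "f ` N \<union> set (take (d + 1) cs)"
  have "card ?S \<le> card (f ` N) + card (set (take (d + 1) cs))" by (rule card_Un_le)
  also have "card (f ` N) \<le> d" using card_image_le[OF assms(1)] assms(2) by (rule le_trans)
  also have "card (set (take (d + 1) cs)) \<le> d + 1"
    by (rule le_trans[OF card_length]) simp
  finally have "card ?S < card {1..k}" using assms(3) by simp
  then have "\<not> {1..k} \<subseteq> ?S"
    using assms(1) card_mono[of ?S "{1..k}"] by auto
  with that show ?thesis by blast
qed

text \<open>
  Here \<open>r\<close> counts the recolourings of \<open>N\<close> for which the present colour of \<open>v\<close> is still safe. Both
  subtractions truncate, so the bound is the ceiling of \<open>(m - r) / (d + 1)\<close>, where \<open>m\<close> is the
  number of recolourings of \<open>N\<close>, and \<open>0\<close> if \<open>m \<le> r\<close>.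
\<close>
lemma extend_recolouring:
  assumes "finite N" "card N \<le> d" "2 * d + 2 \<le> k"
    and N: "in_or_out_cover E V v N" and v: "v \<in> V"
  shows "recolouring E k (V - {v}) f xs \<Longrightarrow> f v \<in> {1..k} \<Longrightarrow> f v \<notin> f ` N \<Longrightarrow>
    f v \<notin> set (take r (colours_on N xs)) \<Longrightarrow>
    \<exists>ys. recolouring E k V f ys \<and> filter (\<lambda>s. fst s \<noteq> v) ys = xs \<and>
      moves v ys \<le> (length (colours_on N xs) - r + d) div (d + 1)"
proof (induction xs arbitrary: f r)
  case Nil
  then have "recolouring E k V f []"
    by (simp add: acyclic_colouring_insert[OF N])
  then show ?case by (intro exI[of _ "[]"]) simp
next
  case (Cons s xs)
  obtain x c where s: "s = (x, c)" by force
  let ?m = "length (colours_on N xs)"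
  have f: "acyclic_colouring E k (V - {v}) f" and x: "x \<in> V" "x \<noteq> v"
    and rec: "recolouring E k (V - {v}) (f(x := c)) xs"
    using Cons.prems(1) by (auto simp: s)
  have fV: "acyclic_colouring E k V f"
    using acyclic_colouring_insert[OF N f] Cons.prems by blast
  have vN: "v \<notin> N" using N by (auto simp: in_or_out_cover_def)
  show ?case
  proof (cases "x \<in> N")
    case False
    then have "(f(x := c)) ` N = f ` N" by auto
    with Cons.prems x s False have "\<exists>ys. recolouring E k V (f(x := c)) ys \<and>
      filter (\<lambda>s. fst s \<noteq> v) ys = xs \<and> moves v ys \<le> (?m - r + d) div (d + 1)"
      by (intro Cons.IH rec) auto
    then obtain ys where "recolouring E k V (f(x := c)) ys" "filter (\<lambda>s. fst s \<noteq> v) ys = xs"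
      "moves v ys \<le> (?m - r + d) div (d + 1)" by blast
    with fV x s False show ?thesis by (intro exI[of _ "(x, c) # ys"]) simp
  next
    case True
    \<comment> \<open>This performs \<open>s\<close> while \<open>v\<close> has the colour
      \<open>g v\<close>. It serves both cases below: \<open>g = f\<close> if \<open>v\<close> can
      stay, \<open>g = f(v := b)\<close> if \<open>v\<close> has just moved.\<close>
    have safe: "\<exists>ys. recolouring E k V g (s # ys) \<and>
        filter (\<lambda>s. fst s \<noteq> v) (s # ys) = s # xs \<and> moves v (s # ys) \<le> (?m - q + d) div (d + 1)"
      if g: "\<And>y. y \<noteq> v \<Longrightarrow> g y = f y" "g v \<in> {1..k}" "g v \<notin> f ` N" "g v \<noteq> c"
        "g v \<notin> set (take q (colours_on N xs))" for g q
    proof -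
      have gN: "g ` N = f ` N" using g(1) vN by (metis (no_types, lifting) image_cong)
      have "acyclic_colouring E k (V - {v}) g"
        using f acyclic_colouring_cong[of "V - {v}" g f] g(1) by auto
      then have gV: "acyclic_colouring E k V g"
        using acyclic_colouring_insert[OF N] g(2,3) gN by simp
      have "recolouring E k (V - {v}) (g(x := c)) xs"
        using rec recolouring_cong[of "V - {v}" "g(x := c)" "f(x := c)"] g(1) by auto
      then have "\<exists>ys. recolouring E k V (g(x := c)) ys \<and>
        filter (\<lambda>s. fst s \<noteq> v) ys = xs \<and> moves v ys \<le> (?m - q + d) div (d + 1)"
      proof (rule Cons.IH)
        show "(g(x := c)) v \<notin> (g(x := c)) ` N" using g(3,4) gN x by auto
      qed (use g(2,5) x in auto)
      then obtain ys where "recolouring E k V (g(x := c)) ys"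
        "filter (\<lambda>s. fst s \<noteq> v) ys = xs" "moves v ys \<le> (?m - q + d) div (d + 1)"
        by blast
      with gV x s show ?thesis by (intro exI[of _ ys]) simp
    qed
    show ?thesis
    proof (cases r)
      \<comment> \<open>The step \<open>s\<close> uses up one safe recolouring: \<open>m\<close> and
        \<open>r\<close> both drop by one, so the bound is unchanged.\<close>
      case (Suc q)
      with Cons.prems s True safe[of f q] obtain ys where "recolouring E k V f (s # ys)"
        "filter (\<lambda>s. fst s \<noteq> v) (s # ys) = s # xs" "moves v (s # ys) \<le> (?m - q + d) div (d + 1)"
        by auto
      with Suc s True show ?thesis by (intro exI[of _ "s # ys"]) simp
    next
      case 0
      \<comment> \<open>The \<open>d + 1\<close> avoided colours are \<open>c\<close>, which is
        about to be used, and the next \<open>d\<close> after it. Hence \<open>d\<close> safe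
        recolourings remain after \<open>s\<close>.\<close>
      obtain b where b: "b \<in> {1..k}" "b \<notin> f ` N" "b \<notin> set (take (d + 1) (c # colours_on N xs))"
        using free_colour[OF assms(1-3)] by blast
      obtain ys where ys: "recolouring E k V (f(v := b)) (s # ys)"
        "filter (\<lambda>s. fst s \<noteq> v) (s # ys) = s # xs" "moves v (s # ys) \<le> (?m - d + d) div (d + 1)"
        using safe[of "f(v := b)" d] b by auto
      \<comment> \<open>One move of \<open>v\<close> is paid for by \<open>d + 1\<close>
        recolourings of \<open>N\<close>. If fewer than \<open>d\<close> remain after
        \<open>s\<close>, the subtraction truncates and both sides are 1.\<close>
      have "Suc ((?m - d + d) div (d + 1)) = (Suc ?m + d) div (d + 1)"
      proof (cases "d \<le> ?m")
        case True
        have "(Suc ?m + d) div (d + 1) = (?m + (d + 1)) div (d + 1)" by simp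
        also have "\<dots> = Suc (?m div (d + 1))" by (subst div_add_self2) auto
        finally show ?thesis using True by simp
      next
        case False
        then have "(Suc ?m + d) div (d + 1) = 1" by (intro div_nat_eqI) auto
        with False show ?thesis by simp
      qed
      with ys fV v s True 0 show ?thesis
        by (intro exI[of _ "(v, b) # s # ys"]) (auto split: if_splits)
    qed
  qed
qed

lemma extend_recolouring_to_target:
  assumes fin: "finite N" and card: "card N \<le> d" and k: "2 * d + 2 \<le> k"
    and N: "in_or_out_cover E V v N" and v: "v \<in> V"
    and f: "acyclic_colouring E k V f" and g: "acyclic_colouring E k V g"
    and xs: "recolouring E k (V - {v}) f xs"
    and final: "\<And>x. x \<in> V - {v} \<Longrightarrow> recolour f xs x = g x"
    and bound: "\<And>x. x \<in> V - {v} \<Longrightarrow> moves x xs \<le> d + 1"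
  shows "\<exists>ys. recolouring E k V f ys \<and> (\<forall>x\<in>V. recolour f ys x = g x) \<and> (\<forall>x\<in>V. moves x ys \<le> d + 1)"
proof -
  let ?m = "length (colours_on N xs)"
  have NV: "N \<subseteq> V - {v}" using N by (simp add: in_or_out_cover_def)
  have fk: "f v \<in> {1..k}" using f v by (auto simp: acyclic_colouring_def)
  obtain ys where ys: "recolouring E k V f ys" "moves v ys \<le> d"
    "filter (\<lambda>s. fst s \<noteq> v) ys = xs"
  \<comment> \<open>With \<open>N\<close> empty, \<open>d\<close> may be 0, which leaves no room for
    an initial move; but then every colour of \<open>v\<close> is safe and \<open>v\<close> stays
    put.\<close>
  proof (cases "N = {}")
    case True
    then have "colours_on N xs = []" by (simp add: colours_on_def)
    moreover have "\<exists>ys. recolouring E k V f ys \<and> filter (\<lambda>s. fst s \<noteq> v) ys = xs \<and>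
        moves v ys \<le> (?m - 0 + d) div (d + 1)"
      by (rule extend_recolouring[OF fin card k N v xs fk]) (use True in simp_all)
    ultimately obtain ys where "recolouring E k V f ys" "filter (\<lambda>s. fst s \<noteq> v) ys = xs"
      "moves v ys \<le> 0"
      by auto
    then show ?thesis by (intro that) auto
  next
    case False
    with fin card have d: "d \<ge> 1" by (cases d) auto
    have "?m = (\<Sum>x\<in>N. moves x xs)" using fin by (rule length_colours_on)
    also have "\<dots> \<le> card N * (d + 1)"
      using sum_bounded_above[of N "\<lambda>x. moves x xs" "d + 1"] bound NV by auto
    also have "\<dots> \<le> d * (d + 1)" using card by (rule mult_le_mono1)
    finally have m: "?m \<le> d * (d + 1)" .
    \<comment> \<open>This settles the case in which \<open>?m - (d + 1)\<close> truncates to 0;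
      otherwise the sum below is \<open>?m - 1\<close>.\<close>
    have "d < d * (d + 1)" using d by simp
    with m have "?m - (d + 1) + d < d * (d + 1)" by linarith
    then have small: "(?m - (d + 1) + d) div (d + 1) < d" by (rule less_mult_imp_div_less)
    \<comment> \<open>The initial move is made because \<open>f v\<close> may itself occur on
      \<open>N\<close>: \<open>f\<close> is only known to be acyclic.\<close>
    obtain b where b: "b \<in> {1..k}" "b \<notin> f ` N" "b \<notin> set (take (d + 1) (colours_on N xs))"
      using free_colour[OF fin card k] by blast
    have "recolouring E k (V - {v}) (f(v := b)) xs"
      using xs recolouring_cong[of "V - {v}" "f(v := b)" f] by auto
    then have "\<exists>ys. recolouring E k V (f(v := b)) ys \<and> filter (\<lambda>s. fst s \<noteq> v) ys = xs \<and>
        moves v ys \<le> (?m - (d + 1) + d) div (d + 1)"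
    proof (rule extend_recolouring[OF fin card k N v])
      have "(f(v := b)) ` N = f ` N" using NV by (intro image_cong) auto
      with b(2) show "(f(v := b)) v \<notin> (f(v := b)) ` N" by simp
    qed (use b in simp_all)
    then obtain ys where ys: "recolouring E k V (f(v := b)) ys"
      "filter (\<lambda>s. fst s \<noteq> v) ys = xs" "moves v ys \<le> (?m - (d + 1) + d) div (d + 1)"
      by blast
    from ys(3) small have "moves v ys < d" by (rule le_less_trans)
    show ?thesis
    proof (rule that)
      show "recolouring E k V f ((v, b) # ys)" using f v ys(1) by simp
    qed (use ys(2) \<open>moves v ys < d\<close> in simp_all)
  qed
  have other: "recolour f ys x = g x" "moves x ys \<le> d + 1" if "x \<in> V - {v}" for x
    using recolour_filter_other[of x v f ys] moves_filter_other[of x v ys] final[OF that]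
      bound[OF that] ys(3) that by auto
  \<comment> \<open>The last move is allowed even if \<open>g v\<close> occurs on \<open>N\<close>,
    since it produces \<open>g\<close> on all of \<open>V\<close>.\<close>
  have "acyclic_colouring E k V ((recolour f ys)(v := g v))"
    using g other acyclic_colouring_cong[of V g "(recolour f ys)(v := g v)"] by auto
  with ys(1) v have "recolouring E k V f (ys @ [(v, g v)])"
    by (simp add: recolouring_append recolouring_final)
  with other ys(2) show ?thesis by (intro exI[of _ "ys @ [(v, g v)]"]) auto
qed

text \<open>The bound is stated for each vertex rather than for the total length, because the
  induction step has to bound the recolourings of the small set \<open>N\<close>.\<close>

theorem short_recolouring:
  assumes k: "2 * d + 2 \<le> k" and "finite V"
    and degen: "\<And>W. W \<subseteq> V \<Longrightarrow> W \<noteq> {} \<Longrightarrow>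
      \<exists>v\<in>W. \<exists>N. card N \<le> d \<and> in_or_out_cover E W v N"
    and "acyclic_colouring E k V f" "acyclic_colouring E k V g"
  shows "\<exists>xs. recolouring E k V f xs \<and> (\<forall>x\<in>V. recolour f xs x = g x) \<and>
    (\<forall>x\<in>V. moves x xs \<le> d + 1)"
  using assms(2-)
proof (induction V rule: finite_psubset_induct)
  case (psubset V)
  show ?case
  proof (cases "V = {}")
    case True
    with psubset.prems show ?thesis by (intro exI[of _ "[]"]) simp
  next
    case False
    with psubset.prems(1)[of V] obtain v N
      where v: "v \<in> V" and N: "card N \<le> d" "in_or_out_cover E V v N" by blast
    then have fin: "finite N"
      using psubset.hyps by (auto simp: in_or_out_cover_def intro: finite_subset)
    have "\<exists>xs. recolouring E k (V - {v}) f xs \<and> (\<forall>x\<in>V - {v}. recolour f xs x = g x) \<and>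
      (\<forall>x\<in>V - {v}. moves x xs \<le> d + 1)"
      using v psubset.prems
      by (intro psubset.IH) (auto intro: acyclic_colouring_subset)
    then obtain xs where "recolouring E k (V - {v}) f xs"
      "\<And>x. x \<in> V - {v} \<Longrightarrow> recolour f xs x = g x" "\<And>x. x \<in> V - {v} \<Longrightarrow> moves x xs \<le> d + 1"
      by blast
    then show ?thesis
      by (rule extend_recolouring_to_target[OF fin N(1) k N(2) v psubset.prems(2,3)])
  qed
qed

section \<open>Dicolourings\<close>

text \<open>A monochromatic cycle is a closed chain of the relation. Conversely, a closed chain is a
  closed walk in the subdigraph of arcs with equally coloured ends; it yields a cycle there, and the
  colour is constant along walks of that subdigraph.\<close>

lemma (in digraph) dicolouring_iff_acyclic_colouring:
  "dicolouring G k f \<longleftrightarrow>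
    f \<in> extensional (verts G) \<and> acyclic_colouring (arcs_ends G) k (verts G) f"
proof -
  let ?M = "mono_rel (arcs_ends G) (verts G) f"
  have "(\<exists>p c. cycle p \<and> (\<forall>e\<in>set p. f (tail G e) = c)) \<longleftrightarrow> \<not> acyclic ?M"
  proof
    assume "\<exists>p c. cycle p \<and> (\<forall>e\<in>set p. f (tail G e) = c)"
    then obtain p c u where p: "awalk u p u" "p \<noteq> []" and c: "\<forall>e\<in>set p. f (tail G e) = c"
      by (auto simp: cycle_def)
    \<comment> \<open>The arcs fix the colours of their tails only, so the endpoint needs
      \<open>f v = c\<close> as a separate assumption; for a closed walk the first arc supplies
      it.\<close>
    have *: "p \<noteq> [] \<Longrightarrow> (w, v) \<in> ?M\<^sup>+"
      if "awalk w p v" "\<forall>e\<in>set p. f (tail G e) = c" "f v = c" for w p v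
      using that
    proof (induction p arbitrary: w)
      case (Cons e p)
      have e: "e \<in> arcs G" "w = tail G e" and p: "awalk (head G e) p v"
        using Cons.prems by (auto simp: awalk_Cons_iff)
      have "f (head G e) = c"
        using p Cons.prems by (cases p) (auto simp: awalk_Nil_iff awalk_Cons_iff)
      with e Cons.prems have "(w, head G e) \<in> ?M"
        by (auto simp: mono_rel_def arcs_ends_conv)
      with Cons p show ?case
        by (cases "p = []") (auto simp: awalk_Nil_iff intro: trancl_into_trancl2)
    qed simp
    have "f u = c" using p c by (cases p) (auto simp: awalk_Cons_iff)
    with * p c have "(u, u) \<in> ?M\<^sup>+" by blast
    then show "\<not> acyclic ?M" by (auto simp: acyclic_def)
  next
    assume "\<not> acyclic ?M"
    then obtain u where u: "(u, u) \<in> ?M\<^sup>+" by (auto simp: acyclic_def)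
    define H where "H = G\<lparr>arcs := {e \<in> arcs G. f (tail G e) = f (head G e)}\<rparr>"
    interpret H: wf_digraph H by unfold_locales (auto simp: H_def)
    have sub: "subgraph H G"
      using wf_digraph H.wf_digraph by (auto simp: subgraph_def compatible_def H_def)
    have "arcs_ends H = ?M" by (auto simp: arcs_ends_conv mono_rel_def H_def)
    with u have "u \<rightarrow>\<^sup>+\<^bsub>H\<^esub> u" by simp
    then obtain q where "H.awalk u q u" "q \<noteq> []" unfolding H.reachable1_awalk by blast
    then have "H.closed_w q" by (auto simp: H.closed_w_def)
    then obtain p where p: "H.cycle p" using H.closed_w_imp_cycle by blast
    then obtain w where w: "H.awalk w p w" by (auto simp: H.cycle_def)
    have "\<forall>e\<in>set p. f (tail G e) = f w" if "H.awalk w p v" for p w v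
      using that
    proof (induction p arbitrary: w)
      case (Cons e p)
      then have e: "e \<in> arcs H" "w = tail H e" and "H.awalk (head H e) p v"
        by (auto simp: H.awalk_Cons_iff)
      then have "\<forall>e'\<in>set p. f (tail G e') = f (head H e)" by (intro Cons.IH)
      with e show ?case by (simp add: H_def)
    qed simp
    from this[OF w] subgraph_cycle[OF sub p] show "\<exists>p c. cycle p \<and> (\<forall>e\<in>set p. f (tail G e) = c)" by blast
  qed
  then show ?thesis
    by (auto simp: dicolouring_def acyclic_colouring_def PiE_def)
qed

text \<open>Steps that change no colour are dropped, since adjacent dicolourings must differ; hence
  only an inequality of lengths.\<close>

lemma (in digraph) dicolouring_graph_walk:
  assumes "recolouring (arcs_ends G) k (verts G) f xs" "f \<in> extensional (verts G)"
  shows "\<exists>p. pre_digraph.awalk (dicolouring_graph G k) f p (recolour f xs) \<and> length p \<le> length xs"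
proof -
  interpret C: graph "dicolouring_graph G k" by (rule graph_dicolouring_graph) unfold_locales
  show ?thesis
    using assms
  proof (induction xs arbitrary: f)
    case Nil
    then have "dicolouring G k f" by (simp add: dicolouring_iff_acyclic_colouring)
    then have "f \<in> verts (dicolouring_graph G k)" by (simp add: dicolouring_graph_def)
    then show ?case by (intro exI[of _ "[]"]) (simp add: C.awalk_Nil_iff)
  next
    case (Cons s xs)
    obtain x c where s: "s = (x, c)" by force
    let ?g = "f(x := c)"
    have x: "x \<in> verts G" and rec: "recolouring (arcs_ends G) k (verts G) ?g xs"
      using Cons.prems by (auto simp: s)
    have g: "?g \<in> extensional (verts G)" using Cons.prems x by (auto simp: extensional_def)
    obtain p where p: "C.awalk ?g p (recolour ?g xs)" "length p \<le> length xs"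
      using Cons.IH[OF rec g] by blast
    show ?case
    proof (cases "f x = c")
      case True
      then have "?g = f" by auto
      with p s show ?thesis by (intro exI[of _ p]) auto
    next
      case False
      have "dicolouring G k f" "dicolouring G k ?g"
        using Cons.prems s g recolouring_imp_acyclic_colouring[OF rec]
        by (auto simp: dicolouring_iff_acyclic_colouring)
      moreover have "\<exists>!v. v \<in> verts G \<and> f v \<noteq> ?g v"
        using x False by (intro ex1I[of _ x]) (auto split: if_splits)
      ultimately have "(f, ?g) \<in> arcs (dicolouring_graph G k)"
        by (simp add: dicolouring_graph_def)
      moreover have "tail (dicolouring_graph G k) = fst" "head (dicolouring_graph G k) = snd"
        by (simp_all add: dicolouring_graph_def)
      ultimately have "C.awalk f ((f, ?g) # p) (recolour ?g xs)"
        using p(1) by (simp add: C.awalk_Cons_iff)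
      with p(2) s show ?thesis by (intro exI[of _ "(f, ?g) # p"]) simp
    qed
  qed
qed

section \<open>Min-degeneracy and the diameter bound\<close>

text \<open>The subdigraph induced by \<open>W\<close> takes part in the maximum, so its minimum
  out-degree or in-degree is small. At a vertex attaining it, the heads or tails of the arcs within
  \<open>W\<close> form \<open>N\<close>.\<close>

lemma (in digraph) min_degeneracy_cover:
  assumes "W \<subseteq> verts G" "W \<noteq> {}"
  shows "\<exists>v\<in>W. \<exists>N. card N \<le> min_degeneracy G \<and> in_or_out_cover (arcs_ends G) W v N"
proof -
  let ?H = "G \<restriction> W"
  have sub: "subgraph ?H G"
    using assms(1) wf_digraph wellformed_induce_subgraph by (auto simp: subgraph_def compatible_def)
  have fin: "finite W" using assms(1) by (rule finite_subset) simp
  have "{min (min_out_degree H) (min_in_degree H) | H. subgraph H G \<and> verts H \<noteq> {}} =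
      (\<lambda>H. min (min_out_degree H) (min_in_degree H)) ` {H. subgraph H G \<and> verts H \<noteq> {}}"
    by auto
  moreover have "finite {H. subgraph H G \<and> verts H \<noteq> {}}"
    by (rule finite_subset[OF _ finite_subgraphs[OF fin_digraph]]) auto
  ultimately have "min (min_out_degree ?H) (min_in_degree ?H) \<le> min_degeneracy G"
    unfolding min_degeneracy_def using sub assms(2) by (intro Max_ge) auto
  then consider "min_out_degree ?H \<le> min_degeneracy G" | "min_in_degree ?H \<le> min_degeneracy G"
    by (auto simp: min_le_iff_disj)
  then show ?thesis
  proof cases
    case 1
    have "min_out_degree ?H \<in> out_degree ?H ` W"
      unfolding min_out_degree_def using fin assms(2) by (auto intro: Min_in)
    then obtain v where v: "v \<in> W" "out_degree ?H v = min_out_degree ?H" by auto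
    let ?N = "head G ` out_arcs ?H v"
    have "card ?N \<le> out_degree ?H v"
      unfolding out_degree_def
      by (rule card_image_le, rule finite_subset[OF _ finite_arcs]) auto
    moreover have "in_or_out_cover (arcs_ends G) W v ?N"
      using no_loops v(1) by (fastforce simp: in_or_out_cover_def arcs_ends_conv)
    ultimately show ?thesis using v 1 by (metis le_trans)
  next
    case 2
    have "min_in_degree ?H \<in> in_degree ?H ` W"
      unfolding min_in_degree_def using fin assms(2) by (auto intro: Min_in)
    then obtain v where v: "v \<in> W" "in_degree ?H v = min_in_degree ?H" by auto
    let ?N = "tail G ` in_arcs ?H v"
    have "card ?N \<le> in_degree ?H v"
      unfolding in_degree_def
      by (rule card_image_le, rule finite_subset[OF _ finite_arcs]) auto
    moreover have "in_or_out_cover (arcs_ends G) W v ?N"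
      using no_loops v(1) by (fastforce simp: in_or_out_cover_def arcs_ends_conv)
    ultimately show ?thesis using v 2 by (metis le_trans)
  qed
qed

lemma (in wf_digraph) unit_distance_le_length:
  assumes "awalk u p v"
  shows "\<mu> (\<lambda>_. 1) u v \<le> ereal (real (length p))"
proof -
  have "awalk_cost (\<lambda>_. 1) p = real (length p)" by (induction p) auto
  with min_cost_le_walk_cost[OF assms, of "\<lambda>_. 1"] show ?thesis by simp
qed

theorem theorem9:
  fixes D :: "('a, 'b) pre_digraph" and n k :: nat
  assumes "digraph D"
    and "card (verts D) = n"
    and "k \<ge> 2 * min_degeneracy D + 2"
  shows "diameter (dicolouring_graph D k) \<le> ereal (real ((min_degeneracy D + 1) * n))"
proof -
  interpret digraph D by fact
  interpret C: graph "dicolouring_graph D k" using assms(1) by (rule graph_dicolouring_graph)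
  let ?d = "min_degeneracy D"
  show ?thesis
    unfolding diameter_def
  proof (intro SUP_least)
    fix f g assume "f \<in> verts (dicolouring_graph D k)" "g \<in> verts (dicolouring_graph D k)"
    then have f: "f \<in> extensional (verts D)" "acyclic_colouring (arcs_ends D) k (verts D) f"
      and g: "g \<in> extensional (verts D)" "acyclic_colouring (arcs_ends D) k (verts D) g"
      by (auto simp: dicolouring_graph_def dicolouring_iff_acyclic_colouring)
    obtain xs where xs: "recolouring (arcs_ends D) k (verts D) f xs"
      and final: "\<forall>x\<in>verts D. recolour f xs x = g x"
      and bound: "\<forall>x\<in>verts D. moves x xs \<le> ?d + 1"
      using short_recolouring[OF assms(3) finite_verts min_degeneracy_cover f(2) g(2)] by blast
    have "length xs = (\<Sum>x\<in>verts D. moves x xs)"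
      using xs by (intro length_eq_sum_moves recolouring_steps) auto
    also have "\<dots> \<le> n * (?d + 1)"
      using sum_bounded_above[of "verts D" "\<lambda>x. moves x xs" "?d + 1"] bound assms(2) by auto
    finally have len: "length xs \<le> (?d + 1) * n" by (simp add: mult.commute)
    \<comment> \<open>Vertices of the dicolouring graph are functions, so equality must also hold
      outside \<open>verts D\<close>; no step acts there, and \<open>f\<close> and \<open>g\<close>
      are both \<open>undefined\<close>.\<close>
    have "recolour f xs x = g x" for x
    proof (cases "x \<in> verts D")
      case False
      then have "recolour f xs x = f x"
        using recolouring_steps[OF xs] by (intro recolour_unmoved) auto
      with False f(1) g(1) show ?thesis by (simp add: extensional_def)
    qed (simp add: final)
    then have "recolour f xs = g" by auto
    with dicolouring_graph_walk[OF xs f(1)] obtain p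
      where p: "C.awalk f p g" "length p \<le> length xs" by auto
    show "C.\<mu> (\<lambda>_. 1) f g \<le> ereal (real ((?d + 1) * n))"
      using C.unit_distance_le_length[OF p(1)]
      by (rule order_trans) (use p(2) len in \<open>simp del: of_nat_mult of_nat_add\<close>)
  qed
qed

end
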